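(* For all $n,d\in\mathbb{N}$ there exists a graph $G_{n,d}$ such that: $G_{n,d}$ has $\frac{3}{2}\binom{2d}{d}n+2d$ vertices; the treedepth of $G_{n,d}$ is at most $2d+2$; and the graph $(G_{n,d})^2$ has at least $n^{\frac{1}{2}\binom{2d}{d}}$ different inclusion-wise maximal cliques.
   Context: All graphs are finite, simple and undirected. $G^2$ is the graph on $V(G)$ where distinct $u,v$ are adjacent iff their distance in $G$ is at most $2$. The treedepth of a graph $G$ is the minimum height (maximum number of vertices on a root-to-leaf path) of a rooted forest $F$ on vertex set $V(G)$ such that every edge of $G$ joins two vertices one of which is an ancestor of the other in $F$.
   Formalization: The case d = 0 with n odd is excluded, because the prescribed number of vertices 3n/2 is then not an integer; all other natural numbers n, d are covered (nothing is excluded when d ≥ 1). *)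

theory Defs
  imports Complex_Main "Graph_Theory.Graph_Theory"
begin

text \<open>
  Finite simple undirected graphs are rendered by \<^locale>\<open>pair_graph\<close>: finite, loop-free,
  symmetric, with arcs being pairs of vertices (hence no parallel edges).
\<close>

text \<open>The distance is the library's shortest-path cost with all arcs of cost 1
  (\<open>\<infinity>\<close> between different components).\<close>

definition graph_dist :: "'a pair_pre_digraph \<Rightarrow> 'a \<Rightarrow> 'a \<Rightarrow> ereal" where
  "graph_dist G u v = wf_digraph.\<mu> (with_proj G) (\<lambda>_. 1) u v"

definition graph_square :: "'a pair_pre_digraph \<Rightarrow> 'a pair_pre_digraph" where
  "graph_square G = \<lparr> pverts = pverts G,
     parcs = {(u, v). u \<in> pverts G \<and> v \<in> pverts G \<and> u \<noteq> v \<and> graph_dist G u v \<le> 2} \<rparr>"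

text \<open>
  A rooted forest is given as a digraph whose arcs point from parents to children:
  there are no directed cycles (the library's \<^const>\<open>forest\<close> refers to directed cycles) and
  every vertex has at most one parent. The roots are the vertices without a parent,
  the leaves those without a child, and the ancestors of \<open>v\<close> are the vertices from which \<open>v\<close>
  is reachable.
\<close>

definition rooted_forest :: "'a pair_pre_digraph \<Rightarrow> bool" where
  "rooted_forest F \<longleftrightarrow> pair_digraph F \<and> forest (with_proj F) \<and>
     (\<forall>v \<in> pverts F. in_degree (with_proj F) v \<le> 1)"

definition root_to_leaf_path :: "'a pair_pre_digraph \<Rightarrow> 'a list \<Rightarrow> bool" where
  "root_to_leaf_path F p \<longleftrightarrow> vpath p (with_proj F) \<and>
     in_degree (with_proj F) (hd p) = 0 \<and> out_degree (with_proj F) (last p) = 0"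

text \<open>Here \<open>length p\<close> is the number of vertices of \<open>p\<close>; the inserted 0 only matters for the
  empty forest, which gets height 0.\<close>

definition forest_height :: "'a pair_pre_digraph \<Rightarrow> nat" where
  "forest_height F = Max (insert 0 (length ` {p. root_to_leaf_path F p}))"

definition elimination_forest :: "'a pair_pre_digraph \<Rightarrow> 'a pair_pre_digraph \<Rightarrow> bool" where
  "elimination_forest F G \<longleftrightarrow> rooted_forest F \<and> pverts F = pverts G \<and>
     (\<forall>(u, v) \<in> parcs G. u \<rightarrow>\<^sup>*\<^bsub>with_proj F\<^esub> v \<or> v \<rightarrow>\<^sup>*\<^bsub>with_proj F\<^esub> u)"

definition treedepth :: "'a pair_pre_digraph \<Rightarrow> nat" where
  "treedepth G = (LEAST h. \<exists>F. elimination_forest F G \<and> forest_height F = h)"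

definition is_clique :: "'a pair_pre_digraph \<Rightarrow> 'a set \<Rightarrow> bool" where
  "is_clique G K \<longleftrightarrow> K \<subseteq> pverts G \<and> (\<forall>u \<in> K. \<forall>v \<in> K. u \<noteq> v \<longrightarrow> (u, v) \<in> parcs G)"

definition maximal_clique :: "'a pair_pre_digraph \<Rightarrow> 'a set \<Rightarrow> bool" where
  "maximal_clique G K \<longleftrightarrow> is_clique G K \<and> (\<forall>K'. is_clique G K' \<and> K \<subseteq> K' \<longrightarrow> K' = K)"

end

(* Split the d-subsets of a set of 2d hubs into complementary pairs (A, A^c).  For each pair take n
   disjoint three-vertex paths a - c - b, joining a to all hubs in A and b to all hubs in A^c.
   Endpoints of paths of different pairs share a hub, whereas for two different paths a - c - b and
   a' - c' - b' of the same pair, a and b' are at distance more than 2.  So any selection of one path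
   per pair spans a clique of the square, and no clique contains two such selections.  Removing the
   2d hubs leaves paths of treedepth 2. *)

theory Submission
  imports Defs
begin

section \<open>Adjacency in the square, in terms of walks\<close>

text \<open>With unit costs the cost of a walk is its length, so distance at most 2 between distinct
  vertices means a walk of one or two arcs. This removes \<open>ereal\<close> distances from
  everything below.\<close>

lemma parcs_graph_square:
  assumes "pair_wf_digraph G"
  shows "parcs (graph_square G) = {(u, v). u \<in> pverts G \<and> v \<in> pverts G \<and> u \<noteq> v \<and>
    ((u, v) \<in> parcs G \<or> (\<exists>w. (u, w) \<in> parcs G \<and> (w, v) \<in> parcs G))}"
proof -
  interpret pair_wf_digraph G by fact
  have cost: "awalk_cost (\<lambda>_. 1) p = real (length p)" for p :: "('a \<times> 'a) list"
    by (induction p) auto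
  have "graph_dist G u v \<le> 2 \<longleftrightarrow>
      (u, v) \<in> parcs G \<or> (\<exists>w. (u, w) \<in> parcs G \<and> (w, v) \<in> parcs G)" (is "?dist \<longleftrightarrow> ?adj")
    if uv: "u \<in> pverts G" "v \<in> pverts G" "u \<noteq> v" for u v
  proof
    assume ?dist
    \<comment> \<open>Being strictly below 3, the infimum yields an actual walk with fewer than 3
      arcs, without showing that it is attained.\<close>
    then have "graph_dist G u v < ereal 3"
      by (rule order.strict_trans1) simp
    then obtain p where p: "awalk u p v" "length p < 3"
      unfolding graph_dist_def \<mu>_def by (auto simp: INF_less_iff cost)
    then consider "p = []" | e where "p = [e]" | e f where "p = [e, f]"
      by (cases p rule: remdups_adj.cases) (auto simp: neq_Nil_conv)
    then show ?adj
    proof cases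
      case 1
      with p uv show ?thesis by (auto simp: awalk_def)
    next
      case 2
      with p show ?thesis by (cases e) (auto simp: awalk_def)
    next
      case 3
      with p show ?thesis by (cases e; cases f) (auto simp: awalk_def)
    qed
  next
    assume ?adj
    then obtain p where p: "awalk u p v" "length p \<le> 2"
    proof (elim disjE exE conjE)
      assume "(u, v) \<in> parcs G"
      then show ?thesis using that[of "[(u, v)]"] uv by (auto simp: awalk_def)
    next
      fix w assume "(u, w) \<in> parcs G" "(w, v) \<in> parcs G"
      then show ?thesis using that[of "[(u, w), (w, v)]"] uv
        by (auto simp: awalk_def dest: wellformed')
    qed
    have "graph_dist G u v \<le> ereal (real (length p))"
      unfolding graph_dist_def using min_cost_le_walk_cost[OF p(1), of "\<lambda>_. 1"] by (simp add: cost)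
    also have "\<dots> \<le> 2"
      using p(2) by simp
    finally show ?dist .
  qed
  then show ?thesis
    by (auto simp: graph_square_def)
qed

section \<open>Upper bounds on treedepth\<close>

lemma length_vwalk_le:
  assumes lvl: "\<And>u v. (u, v) \<in> arcs_ends F \<Longrightarrow> lvl u < lvl v"
    and bound: "\<And>v. v \<in> verts F \<Longrightarrow> lvl v < (k :: nat)"
    and "vwalk p F"
  shows "length p \<le> k"
proof -
  \<comment> \<open>Adding the level of the head makes the bound pass from the tail to the whole
    walk.\<close>
  have "lvl (hd p) + length p \<le> k"
    using \<open>vwalk p F\<close>
  proof (induction p rule: vwalk_arcs.induct)
    case (2 x)
    then show ?case using bound[of x] by (auto simp: vwalk_def)
  next
    case (3 x y xs)
    then show ?case using lvl[of x y] by (fastforce simp: vwalk_def)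
  qed (auto simp: vwalk_def)
  then show ?thesis by simp
qed

lemma pcas_increasing:
  assumes "\<And>u v. (u, v) \<in> R \<Longrightarrow> lvl u < (lvl v :: nat)"
    and "pcas u p v" "set p \<subseteq> R" "p \<noteq> []"
  shows "lvl u < lvl v"
  using assms(2-)
proof (induction p arbitrary: u)
  case (Cons e p)
  have "lvl u < lvl (snd e)" using Cons.prems assms(1)[of u "snd e"] by (cases e) auto
  moreover have "lvl (snd e) \<le> lvl v"
    using Cons.IH[of "snd e"] Cons.prems by (cases "p = []") auto
  ultimately show ?case by simp
qed simp

text \<open>\<open>R\<close> is the parent relation of a candidate forest. A single function
  \<open>lvl\<close> rules out directed cycles, since it would have to increase around them, and
  bounds root-to-leaf paths, since at most \<open>k\<close> values are available.\<close>

lemma treedepth_le: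
  fixes R :: "'a rel" and lvl :: "'a \<Rightarrow> nat"
  assumes G: "pair_graph G"
    and sub: "R \<subseteq> pverts G \<times> pverts G"
    and parent: "\<And>u u' v. (u, v) \<in> R \<Longrightarrow> (u', v) \<in> R \<Longrightarrow> u = u'"
    and lvl: "\<And>u v. (u, v) \<in> R \<Longrightarrow> lvl u < lvl v"
    and bound: "\<And>v. v \<in> pverts G \<Longrightarrow> lvl v < k"
    and comparable: "\<And>u v. (u, v) \<in> parcs G \<Longrightarrow> (u, v) \<in> R\<^sup>* \<or> (v, u) \<in> R\<^sup>*"
  shows "treedepth G \<le> k"
proof -
  interpret G: pair_graph G by fact
  define F where "F = \<lparr>pverts = pverts G, parcs = R\<rparr>"
  have F_simps[simp]: "pverts F = pverts G" "parcs F = R" by (simp_all add: F_def)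
  have "finite R"
    using sub finite_subset G.pair_finite_verts by blast
  interpret F: pair_digraph F
  proof unfold_locales
    show "e \<in> parcs F \<Longrightarrow> fst e \<noteq> snd e" for e using lvl[of "fst e" "snd e"] by auto
  qed (use sub G.pair_finite_verts \<open>finite R\<close> in auto)
  have "\<not> F.cycle p" for p
    using pcas_increasing[of R lvl _ p, OF lvl] by (auto simp: F.cycle_def F.awalk_def)
  then have "forest (with_proj F)"
    by (simp add: forest_def)
  moreover have "in_degree (with_proj F) v \<le> 1" for v
  proof -
    have "e = f" if "e \<in> in_arcs (with_proj F) v" "f \<in> in_arcs (with_proj F) v" for e f
      using that parent by (cases e; cases f) auto
    then have "card (in_arcs (with_proj F) v) \<le> Suc 0"
      by (subst card_le_Suc0_iff_eq) (use F.finite_in_arcs in auto)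
    then show ?thesis
      by (simp add: in_degree_def)
  qed
  ultimately have rooted: "rooted_forest F"
    by (simp add: rooted_forest_def F.pair_digraph_axioms)
  have reach: "u \<rightarrow>\<^sup>*\<^bsub>with_proj F\<^esub> v" if "u \<in> pverts G" "(u, v) \<in> R\<^sup>*" for u v
    using that(2,1)
  proof (induction rule: rtrancl_induct)
    case (step y z)
    then show ?case using F.reachable_adj_trans[of u y z] by simp
  qed simp
  have "elimination_forest F G"
    unfolding elimination_forest_def using rooted comparable G.wellformed' reach
    by (metis (lifting) F_simps(1) case_prodI2)
  then have "treedepth G \<le> forest_height F"
    unfolding treedepth_def by (intro Least_le exI[of _ F] conjI refl)
  moreover have "length p \<le> k" if "root_to_leaf_path F p" for p
    by (rule length_vwalk_le[of "with_proj F" lvl])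
      (use that lvl bound in \<open>auto simp: root_to_leaf_path_def vpath_def\<close>)
  then have "length ` {p. root_to_leaf_path F p} \<subseteq> {..k}" by auto
  then have "forest_height F \<le> k"
    unfolding forest_height_def by (subst Max_le_iff) (auto intro: finite_subset)
  ultimately show ?thesis by simp
qed

section \<open>Counting maximal cliques\<close>

lemma maximal_clique_extends:
  assumes "finite (pverts G)" "is_clique G K"
  obtains M where "maximal_clique G M" "K \<subseteq> M"
proof -
  have "finite {K. is_clique G K}"
    by (rule finite_subset[of _ "Pow (pverts G)"]) (use assms in \<open>auto simp: is_clique_def\<close>)
  from finite_has_maximal2[OF this, of K] assms(2) that show ?thesis
    unfolding maximal_clique_def by (metis mem_Collect_eq)
qed

lemma finite_maximal_cliques:
  assumes "finite (pverts G)"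
  shows "finite {K. maximal_clique G K}"
  by (rule finite_subset[of _ "Pow (pverts G)"])
    (use assms in \<open>auto simp: maximal_clique_def is_clique_def\<close>)

text \<open>Extend each \<open>K c\<close> to a maximal clique. A common extension of
  \<open>K c\<close> and \<open>K c'\<close> would make their union a clique, so the extensions are
  distinct. The sets \<open>K c\<close> themselves may fail to be maximal.\<close>

lemma card_maximal_cliques_ge:
  assumes fin: "finite (pverts G)"
    and clique: "\<And>c. c \<in> C \<Longrightarrow> is_clique G (K c)"
    and apart: "\<And>c c'. c \<in> C \<Longrightarrow> c' \<in> C \<Longrightarrow> c \<noteq> c' \<Longrightarrow> \<not> is_clique G (K c \<union> K c')"
  shows "card C \<le> card {K. maximal_clique G K}"
proof -
  have "\<forall>c\<in>C. \<exists>M. maximal_clique G M \<and> K c \<subseteq> M"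
    using maximal_clique_extends[OF fin clique] by metis
  then obtain M where M: "\<And>c. c \<in> C \<Longrightarrow> maximal_clique G (M c) \<and> K c \<subseteq> M c"
    by metis
  have "inj_on M C"
  proof (rule inj_onI, rule ccontr)
    fix c c' assume c: "c \<in> C" "c' \<in> C" "M c = M c'" "c \<noteq> c'"
    then have "is_clique G (M c)" "K c \<union> K c' \<subseteq> M c"
      using M[of c] M[of c'] by (auto simp: maximal_clique_def)
    then have "is_clique G (K c \<union> K c')"
      unfolding is_clique_def by blast
    with apart c show False by blast
  qed
  then show ?thesis
    using M finite_maximal_cliques[OF fin] by (intro card_inj_on_le[of M]) auto
qed

section \<open>The graph of hubs and three-vertex paths\<close>

text \<open>Hubs and path vertices are the two summands of a countable sum type, encoded so that
  vertices are natural numbers.\<close>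

definition hub :: "nat \<Rightarrow> nat" where
  "hub h = to_nat (Inl h :: nat + nat \<times> nat \<times> nat)"

text \<open>The \<open>i\<close>-th path of the \<open>s\<close>-th pair has endpoints \<open>cell s i 0\<close>, \<open>cell s i 1\<close>
  and midpoint \<open>cell s i 2\<close>.\<close>

definition cell :: "nat \<Rightarrow> nat \<Rightarrow> nat \<Rightarrow> nat" where
  "cell s i t = to_nat (Inr (s, i, t) :: nat + nat \<times> nat \<times> nat)"

lemma hub_cell_simps [simp]:
  "hub h = hub h' \<longleftrightarrow> h = h'"
  "cell s i t = cell s' i' t' \<longleftrightarrow> s = s' \<and> i = i' \<and> t = t'"
  "hub h \<noteq> cell s i t" "cell s i t \<noteq> hub h"
  by (simp_all add: hub_def cell_def)

text \<open>Depth in the elimination forest used below: the \<open>D\<close> hubs form a chain on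
  top, followed by midpoints and then endpoints.\<close>

definition level :: "nat \<Rightarrow> nat \<Rightarrow> nat" where
  "level D v = (case from_nat v :: nat + nat \<times> nat \<times> nat of
     Inl h \<Rightarrow> h | Inr (s, i, t) \<Rightarrow> if t = 2 then D else D + 1)"

lemma level_simps [simp]:
  "level D (hub h) = h"
  "level D (cell s i t) = (if t = 2 then D else D + 1)"
  by (simp_all add: level_def hub_def cell_def)

text \<open>\<open>B s t\<close> is the set of hubs joined to the ends of kind \<open>t\<close> of
  the paths with index \<open>s\<close>. Meeting sets bring ends with different indices within
  distance 2; disjointness of \<open>B s 0\<close> and \<open>B s 1\<close> keeps opposite ends of
  different paths with the same index apart.\<close>

lemma hub_path_graph_exists:
  fixes D m n :: nat and B :: "nat \<Rightarrow> nat \<Rightarrow> nat set"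
  assumes B_sub: "\<And>s t. s < m \<Longrightarrow> t < 2 \<Longrightarrow> B s t \<subseteq> {..<D}"
    and B_meet: "\<And>s s' t t'. s < m \<Longrightarrow> s' < m \<Longrightarrow> t < 2 \<Longrightarrow> t' < 2 \<Longrightarrow> s \<noteq> s' \<Longrightarrow> B s t \<inter> B s' t' \<noteq> {}"
    and B_disj: "\<And>s. s < m \<Longrightarrow> B s 0 \<inter> B s 1 = {}"
  shows "\<exists>G :: nat pair_pre_digraph. pair_graph G \<and> card (pverts G) = 3 * m * n + D \<and>
    treedepth G \<le> D + 2 \<and> n ^ m \<le> card {K. maximal_clique (graph_square G) K}"
proof -
  define V where "V = hub ` {..<D} \<union> (\<lambda>(s, i, t). cell s i t) ` ({..<m} \<times> {..<n} \<times> {..<3})"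
  \<comment> \<open>Each edge is listed once, directed from ancestor to descendant in the forest
    \<open>R\<close> below; \<open>G\<close> takes the symmetric closure.\<close>
  define E where "E =
    {(hub h, cell s i t) | h s i t. s < m \<and> i < n \<and> t < 2 \<and> h \<in> B s t} \<union>
    {(cell s i 2, cell s i t) | s i t. s < m \<and> i < n \<and> t < 2}"
  define G where "G = \<lparr>pverts = V, parcs = E \<union> E\<inverse>\<rparr>"
  have [simp]: "pverts G = V" "parcs G = E \<union> E\<inverse>" by (simp_all add: G_def)
  have hub_V: "hub h \<in> V \<longleftrightarrow> h < D" for h by (auto simp: V_def)
  have cell_V: "cell s i t \<in> V \<longleftrightarrow> s < m \<and> i < n \<and> t < 3" for s i t
    by (force simp: V_def)
  have fin: "finite V" by (simp add: V_def)
  have E_V: "E \<subseteq> V \<times> V"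
    using B_sub by (fastforce simp: E_def hub_V cell_V)
  have "finite (E \<union> E\<inverse>)"
    using finite_subset[OF E_V] fin by simp
  then have G: "pair_graph G"
  proof unfold_locales
    show "e \<in> parcs G \<Longrightarrow> fst e \<noteq> snd e" for e by (auto simp: E_def)
    show "symmetric (with_proj G)" by (auto simp: symmetric_def intro!: symI)
  qed (use E_V fin in auto)
  then have wf: "pair_wf_digraph G"
    by (simp add: pair_graph_def pair_digraph_def pair_fin_digraph_def)
  have "card V = D + m * n * 3"
    unfolding V_def
    by (subst card_Un_disjoint) (auto simp: card_image inj_on_def card_cartesian_product)
  then have card: "card (pverts G) = 3 * m * n + D" by simp

  \<comment> \<open>The hubs form a path, every midpoint hangs from the last hub, and the two ends
    of a path hang from its midpoint. For \<open>D = 0\<close> the midpoints are the roots.\<close>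
  define R where "R =
    {(hub h, hub (Suc h)) | h. Suc h < D} \<union>
    {(hub h, cell s i 2) | h s i. Suc h = D \<and> s < m \<and> i < n} \<union>
    {(cell s i 2, cell s i t) | s i t. s < m \<and> i < n \<and> t < 2}"
  have hub_chain: "(hub h, hub h') \<in> R\<^sup>*" if "h \<le> h'" "h' < D" for h h'
    using that
  proof (induction h' rule: dec_induct)
    case (step h')
    then have "(hub h, hub h') \<in> R\<^sup>*" "(hub h', hub (Suc h')) \<in> R" by (auto simp: R_def)
    then show ?case by simp
  qed simp
  have hub_cell: "(hub h, cell s i t) \<in> R\<^sup>*" if "h < D" "s < m" "i < n" "t < 2" for h s i t
  proof -
    have "(hub h, hub (D - 1)) \<in> R\<^sup>*" using hub_chain that by simp
    also have "(hub (D - 1), cell s i 2) \<in> R" using that by (auto simp: R_def)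
    also have "(cell s i 2, cell s i t) \<in> R" using that by (auto simp: R_def)
    finally show ?thesis .
  qed
  have E_R: "E \<subseteq> R\<^sup>*"
  proof (rule subrelI)
    fix u v assume "(u, v) \<in> E"
    then consider h s i t where "u = hub h" "v = cell s i t" "s < m" "i < n" "t < 2" "h \<in> B s t"
      | "(u, v) \<in> R"
      by (auto simp: E_def R_def)
    then show "(u, v) \<in> R\<^sup>*"
      using hub_cell B_sub by cases (auto, blast)
  qed
  have "treedepth G \<le> D + 2"
  proof (rule treedepth_le[OF G, of R "level D"])
    show "R \<subseteq> pverts G \<times> pverts G" by (auto simp: R_def hub_V cell_V)
    show "\<And>u u' v. (u, v) \<in> R \<Longrightarrow> (u', v) \<in> R \<Longrightarrow> u = u'" by (auto simp: R_def)
    show "\<And>u v. (u, v) \<in> R \<Longrightarrow> level D u < level D v" by (auto simp: R_def)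
    show "\<And>v. v \<in> pverts G \<Longrightarrow> level D v < D + 2" by (auto simp: V_def)
    show "\<And>u v. (u, v) \<in> parcs G \<Longrightarrow> (u, v) \<in> R\<^sup>* \<or> (v, u) \<in> R\<^sup>*" using E_R by auto
  qed

  \<comment> \<open>A choice \<open>c\<close> selects one path per index. Only ends are collected:
    midpoints of paths with different indices have no common neighbour.\<close>
  define K where "K c = {cell s (c s) t | s t. s < m \<and> t < 2}" for c :: "nat \<Rightarrow> nat"
  define C where "C = ({..<m} \<rightarrow>\<^sub>E {..<n})"
  have square: "is_clique (graph_square G) L \<longleftrightarrow> L \<subseteq> V \<and> (\<forall>u\<in>L. \<forall>v\<in>L. u \<noteq> v \<longrightarrow>
      (u, v) \<in> E \<union> E\<inverse> \<or> (\<exists>w. (u, w) \<in> E \<union> E\<inverse> \<and> (w, v) \<in> E \<union> E\<inverse>))" for L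
    unfolding is_clique_def parcs_graph_square[OF wf]
    by (auto simp: graph_square_def subset_iff)
  have "card C \<le> card {K. maximal_clique (graph_square G) K}"
  proof (rule card_maximal_cliques_ge[of _ _ K])
    show "finite (pverts (graph_square G))" using fin by (simp add: graph_square_def)
  next
    fix c assume c: "c \<in> C"
    have c_less: "c s < n" if "s < m" for s using c that by (auto simp: C_def)
    \<comment> \<open>The common neighbour is the midpoint of the path if the indices agree, and a
      shared hub otherwise.\<close>
    have "\<exists>w. (u, w) \<in> E \<union> E\<inverse> \<and> (w, v) \<in> E \<union> E\<inverse>" if uv: "u \<in> K c" "v \<in> K c" "u \<noteq> v" for u v
    proof -
      obtain s t s' t' where u: "u = cell s (c s) t" "s < m" "t < 2"
        and v: "v = cell s' (c s') t'" "s' < m" "t' < 2"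
        using uv by (auto simp: K_def)
      show ?thesis
      proof (cases "s = s'")
        case True
        then have "(cell s (c s) 2, u) \<in> E" "(cell s (c s) 2, v) \<in> E"
          using u v c_less by (auto simp: E_def)
        then show ?thesis by blast
      next
        case False
        then obtain h where "h \<in> B s t" "h \<in> B s' t'"
          using B_meet u v by (meson disjoint_iff)
        then have "(hub h, u) \<in> E" "(hub h, v) \<in> E"
          using u v c_less by (auto simp: E_def)
        then show ?thesis by blast
      qed
    qed
    moreover have "K c \<subseteq> V" using c_less by (auto simp: K_def cell_V)
    ultimately show "is_clique (graph_square G) (K c)" unfolding square by blast
  next
    fix c c' assume c: "c \<in> C" "c' \<in> C" "c \<noteq> c'"
    \<comment> \<open>Members of \<open>C\<close> agree outside \<open>{..<m}\<close> by
      extensionality, so they differ at an index below \<open>m\<close>.\<close>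
    then obtain s where s: "s < m" "c s \<noteq> c' s"
      unfolding C_def by (metis PiE_ext lessThan_iff)
    \<comment> \<open>Opposite ends are essential: they share no hub, and their midpoints are
      different because the paths are.\<close>
    let ?u = "cell s (c s) 0" and ?v = "cell s (c' s) 1"
    have "?u \<in> K c \<union> K c'" "?v \<in> K c \<union> K c'" "?u \<noteq> ?v" using s by (auto simp: K_def)
    moreover have "(?u, ?v) \<notin> E \<union> E\<inverse>" by (auto simp: E_def)
    moreover have "\<not> ((?u, w) \<in> E \<union> E\<inverse> \<and> (w, ?v) \<in> E \<union> E\<inverse>)" for w
      using s B_disj[of s] by (auto simp: E_def)
    ultimately show "\<not> is_clique (graph_square G) (K c \<union> K c')" unfolding square by blast
  qed
  moreover have "card C = n ^ m" by (simp add: C_def card_PiE)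
  ultimately show ?thesis using G card \<open>treedepth G \<le> D + 2\<close> by auto
qed

section \<open>Complementary pairs of half-size subsets\<close>

text \<open>Requiring \<open>0 \<in> A\<close> picks one set from each complementary pair;
  \<open>d \<ge> 1\<close> guarantees that 0 lies in the ground set.\<close>

lemma half_subsets_halved:
  fixes d :: nat
  assumes "d \<ge> 1"
  defines "S \<equiv> {A. A \<subseteq> {..<2 * d} \<and> card A = d \<and> 0 \<in> A}"
  shows "2 * card S = (2 * d) choose d"
proof -
  let ?U = "{..<2 * d}"
  have compl: "card (?U - A) = d" if "A \<subseteq> ?U" "card A = d" for A
    using that by (simp add: card_Diff_subset finite_subset)
  have fin: "finite S" by (rule finite_subset[of _ "Pow ?U"]) (auto simp: S_def)
  have "{A. A \<subseteq> ?U \<and> card A = d} = S \<union> (\<lambda>A. ?U - A) ` S"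
  proof (intro equalityI subsetI)
    fix A assume A: "A \<in> {A. A \<subseteq> ?U \<and> card A = d}"
    show "A \<in> S \<union> (\<lambda>A. ?U - A) ` S"
    proof (cases "0 \<in> A")
      case False
      then have "?U - A \<in> S" "A = ?U - (?U - A)" using A compl assms(1) by (auto simp: S_def)
      then show ?thesis by blast
    qed (use A in \<open>auto simp: S_def\<close>)
  next
    fix A assume "A \<in> S \<union> (\<lambda>A. ?U - A) ` S"
    then show "A \<in> {A. A \<subseteq> ?U \<and> card A = d}"
      by (elim UnE imageE) (simp_all add: S_def compl)
  qed
  moreover have "S \<inter> (\<lambda>A. ?U - A) ` S = {}" by (auto simp: S_def)
  moreover have "card ((\<lambda>A. ?U - A) ` S) = card S"
    by (intro card_image inj_onI) (auto simp: S_def)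
  ultimately have "2 * card S = card {A. A \<subseteq> ?U \<and> card A = d}"
    using fin by (simp add: card_Un_disjoint)
  then show ?thesis by (simp add: n_subsets)
qed

text \<open>The sets share 0. Being distinct and of equal size, neither contains the other. As they
  overlap and their sizes sum to \<open>2 * d\<close>, their union misses a point, which lies in
  both complements.\<close>

lemma half_subsets_meet:
  fixes d :: nat
  assumes "A \<subseteq> {..<2 * d}" "card A = d" "0 \<in> A" "A' \<subseteq> {..<2 * d}" "card A' = d" "0 \<in> A'" "A \<noteq> A'"
  shows "A \<inter> A' \<noteq> {}" "A \<inter> ({..<2 * d} - A') \<noteq> {}" "({..<2 * d} - A) \<inter> ({..<2 * d} - A') \<noteq> {}"
proof -
  have fin: "finite A" "finite A'" using assms finite_subset by blast+
  show "A \<inter> A' \<noteq> {}" using assms by blast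
  have "\<not> A \<subseteq> A'" using assms fin card_subset_eq by metis
  then show "A \<inter> ({..<2 * d} - A') \<noteq> {}" using assms(1) by blast
  have "card (A \<inter> A') \<noteq> 0" using assms fin by auto
  then have "card (A \<union> A') < card {..<2 * d}"
    using card_Un_Int[OF fin] assms(2,5) by simp
  then have "{..<2 * d} \<noteq> A \<union> A'" by (metis less_irrefl)
  then show "({..<2 * d} - A) \<inter> ({..<2 * d} - A') \<noteq> {}" using assms(1,4) by blast
qed

section \<open>The case \<open>d = 0\<close>\<close>

text \<open>For \<open>d = 0\<close> the binomial coefficient is 1, so there is no whole number of
  complementary pairs to build on. Isolated vertices serve instead, each giving its own maximal
  clique.\<close>

lemma edgeless_graph:
  fixes N :: nat
  defines "G \<equiv> \<lparr>pverts = {..<N}, parcs = {}\<rparr>"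
  shows "pair_graph G" "treedepth G \<le> 1" "N \<le> card {K. maximal_clique (graph_square G) K}"
proof -
  show G: "pair_graph G"
    by unfold_locales (auto simp: G_def symmetric_def sym_def)
  show "treedepth G \<le> 1"
    by (rule treedepth_le[OF G, of "{}" "\<lambda>_. 0"]) (auto simp: G_def)
  have wf: "pair_wf_digraph G"
    using G by (simp add: pair_graph_def pair_digraph_def pair_fin_digraph_def)
  have "card {..<N} \<le> card {K. maximal_clique (graph_square G) K}"
    by (rule card_maximal_cliques_ge[of _ _ "\<lambda>v. {v}"])
      (auto simp: is_clique_def parcs_graph_square[OF wf], auto simp: G_def graph_square_def)
  then show "N \<le> card {K. maximal_clique (graph_square G) K}" by simp
qed

section \<open>Assembling the two cases\<close>

text \<open>For \<open>d = 0\<close> the prescribed number of vertices is 3n/2, an integer only for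
  even \<open>n\<close>; this is what the assumption provides.\<close>

theorem theorem6p5:
  fixes n d :: nat
  assumes "d \<ge> 1 \<or> even n"
  shows "\<exists>G :: nat pair_pre_digraph.
    pair_graph G \<and>
    real (card (pverts G)) = 3 / 2 * real ((2 * d) choose d) * real n + 2 * real d \<and>
    treedepth G \<le> 2 * d + 2 \<and>
    real (card {K. maximal_clique (graph_square G) K})
      \<ge> real n powr (1 / 2 * real ((2 * d) choose d))"
proof (cases "d = 0")
  case True
  with assms obtain k where k: "n = 2 * k" by auto
  let ?G = "\<lparr>pverts = {..<3 * k}, parcs = {}\<rparr>"
  have "real n powr (1 / 2) \<le> real n"
    using powr_mono[of "1 / 2" 1 "real n"] by (cases "n = 0") auto
  also have "\<dots> \<le> real (3 * k)" using k by simp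
  also have "\<dots> \<le> real (card {K. maximal_clique (graph_square ?G) K})"
    using edgeless_graph(3)[of "3 * k"] by simp
  finally show ?thesis
    using edgeless_graph(1,2)[of "3 * k"] True k by (intro exI[of _ ?G]) simp
next
  case False
  let ?U = "{..<2 * d}"
  define S where "S = {A. A \<subseteq> ?U \<and> card A = d \<and> 0 \<in> A}"
  define m where "m = card S"
  have m: "2 * m = (2 * d) choose d"
    using half_subsets_halved[of d] False by (simp add: m_def S_def)
  have "finite S" by (rule finite_subset[of _ "Pow ?U"]) (auto simp: S_def)
  then obtain A where "bij_betw A {..<m} S"
    unfolding m_def lessThan_atLeast0 using ex_bij_betw_nat_finite by blast
  then have A: "A s \<subseteq> ?U \<and> card (A s) = d \<and> 0 \<in> A s" and A_inj: "s' < m \<Longrightarrow> s \<noteq> s' \<Longrightarrow> A s \<noteq> A s'"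
    if "s < m" for s s'
    using that by (auto simp: bij_betw_def S_def inj_on_def)
  define B where "B s t = (if t = 0 then A s else ?U - A s)" for s and t :: nat
  have "\<exists>G :: nat pair_pre_digraph. pair_graph G \<and> card (pverts G) = 3 * m * n + 2 * d \<and>
    treedepth G \<le> 2 * d + 2 \<and> n ^ m \<le> card {K. maximal_clique (graph_square G) K}"
  proof (rule hub_path_graph_exists)
    show "B s t \<subseteq> ?U" if "s < m" for s t
      using A[OF that] by (auto simp: B_def)
    show "B s 0 \<inter> B s 1 = {}" for s by (auto simp: B_def)
    show "B s t \<inter> B s' t' \<noteq> {}" if "s < m" "s' < m" "s \<noteq> s'" for s s' t t'
      \<comment> \<open>The swapped instance covers a complement meeting a set.\<close>
      using half_subsets_meet[of "A s" d "A s'"] half_subsets_meet(2)[of "A s'" d "A s"]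
        A[OF that(1)] A[OF that(2)] A_inj[OF that(1) that(2) that(3)]
      by (auto simp: B_def Int_commute)
  qed
  then obtain G :: "nat pair_pre_digraph" where G: "pair_graph G"
    "card (pverts G) = 3 * m * n + 2 * d" "treedepth G \<le> 2 * d + 2"
    "n ^ m \<le> card {K. maximal_clique (graph_square G) K}"
    by blast
  have half: "1 / 2 * real ((2 * d) choose d) = real m"
    by (simp flip: m)
  \<comment> \<open>An inequality is enough and avoids a clash at zero: \<open>0 powr x\<close> is 0
    for every \<open>x\<close>, whereas \<open>0 ^ 0\<close> is 1.\<close>
  have "real n powr real m \<le> real (n ^ m)"
    by (cases "n = 0") (auto simp: powr_realpow)
  also have "\<dots> \<le> real (card {K. maximal_clique (graph_square G) K})"
    using G(4) by (simp only: of_nat_le_iff)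
  finally have "real n powr (1 / 2 * real ((2 * d) choose d))
    \<le> real (card {K. maximal_clique (graph_square G) K})"
    unfolding half .
  moreover have "real (card (pverts G)) = 3 / 2 * real ((2 * d) choose d) * real n + 2 * real d"
    by (simp add: G(2) flip: m)
  ultimately show ?thesis using G by blast
qed

end
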